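(* Let $\mu\ge 2$ and $\lambda\ge 1$ be integers and let $\epsilon\ge\log_\mu 2$ be real. Let $N$ be a positive integer with $$\log_2 N\ \ge\ 4\mu^{2+\epsilon}+\Big(1+\frac{1}{\epsilon}\Big)\lambda .$$ Then for every positive integer $m$ and every $\mu$-linear polynomial $f\in\mathbb{Z}[X_1,\dots,X_\mu]$ co-prime to $N$, $$\Pr_{\mathbf{x}\leftarrow\{0,\dots,m-1\}^\mu}\big[f(\mathbf{x})\equiv 0\pmod N\big]\le 2^{-\lambda}+\frac{\mu}{m},$$ where $\mathbf{x}$ is uniform on $\{0,\dots,m-1\}^\mu$.
   Context: A polynomial $f\in\mathbb{Z}[X_1,\dots,X_\mu]$ is $\mu$-linear (multilinear) if it has degree at most $1$ in each variable. $f$ is co-prime to $N$ if the greatest common divisor of $N$ and all coefficients of $f$ equals $1$. *)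

theory Defs
  imports "HOL-Analysis.Analysis"
begin

text \<open>A \<mu>-linear polynomial in Z[X_0,...,X_{\<mu>-1}] is given by its coefficient
  function c, where c S is the coefficient of the monomial prod_{i in S} X_i,
  for S a subset of {0..<\<mu>} (values of c outside Pow {..<\<mu>} are irrelevant).\<close>

definition ml_eval :: "nat \<Rightarrow> (nat set \<Rightarrow> int) \<Rightarrow> (nat \<Rightarrow> int) \<Rightarrow> int" where
  "ml_eval \<mu> c x = (\<Sum>S\<in>Pow {..<\<mu>}. c S * (\<Prod>i\<in>S. x i))"

definition coprime_to :: "nat \<Rightarrow> (nat set \<Rightarrow> int) \<Rightarrow> int \<Rightarrow> bool" where
  "coprime_to \<mu> c N \<longleftrightarrow> Gcd (insert N (c ` Pow {..<\<mu>})) = 1"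

end

theory Submission
  imports Defs
begin

text \<open>
  Substitute values for the variables one at a time and follow, for each prime \<open>p\<close> dividing
  \<open>N\<close>, the power of \<open>p\<close> in the content of the resulting polynomial. For a uniform residue
  each substitution would raise the \<open>p\<close>-adic valuation by at most a geometric variable of
  parameter \<open>1/p\<close>, independently over \<open>p\<close>; working with the interval
  \<open>{0..m-1}\<close> instead costs an additive \<open>1/m\<close> per variable. So the probability is at most
  \<open>\<mu>/m\<close> plus the product over \<open>p\<close> of the negative binomial tails.

  To bound the product put \<open>s = \<epsilon>/(1+\<epsilon>)\<close> and \<open>B = \<mu>\<^sup>1\<^sup>+\<^sup>\<epsilon>\<close>. A union bound gives
  \<open>(\<mu>/p)\<^sup>r \<le> p\<^sup>-\<^sup>s\<^sup>r\<close> when \<open>p \<ge> B\<close>. For \<open>p < B\<close> a Chernoff bound gives \<open>p\<^sup>-\<^sup>s\<^sup>r\<close> up to a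
  factor whose logarithm is \<open>\<mu>\<close> times a quantity summing over \<open>p < B\<close> to at most \<open>4 s B\<close>.
  Hence the product is at most \<open>N\<^sup>-\<^sup>s\<close> times two to the power \<open>4 s \<mu> B\<close>.
\<close>

section \<open>Negative binomial tails\<close>

text \<open>The probability that a sum of \<open>k\<close> independent geometric variables is at least \<open>r\<close>,
  where each variable is at least \<open>j\<close> with probability \<open>q ^ j\<close>.\<close>

fun nbtail :: "real \<Rightarrow> nat \<Rightarrow> nat \<Rightarrow> real" where
  "nbtail q 0 r = (if r = 0 then 1 else 0)"
| "nbtail q (Suc k) 0 = 1"
| "nbtail q (Suc k) (Suc r) = (1 - q) * nbtail q k (Suc r) + q * nbtail q (Suc k) r"

lemma nbtail_0 [simp]: "nbtail q k 0 = 1"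
  by (cases k) auto

lemma nbtail_nonneg:
  assumes "0 \<le> q" "q \<le> 1"
  shows "nbtail q k r \<ge> 0"
  using assms by (induction q k r rule: nbtail.induct) auto

text \<open>Unfolding the recursion once reduces the claim for \<open>Suc k\<close> to monotonicity
  in the number of variables, which itself rests on the claim for \<open>k\<close>.\<close>

lemma nbtail_Suc_le:
  assumes q: "0 \<le> q" "q \<le> 1"
  shows "nbtail q k (Suc r) \<le> nbtail q k r"
proof (induction k arbitrary: r)
  case (Suc k)
  have mono: "nbtail q k r \<le> nbtail q (Suc k) r" for r
  proof (induction r)
    case (Suc r)
    have "nbtail q k (Suc r) \<le> nbtail q (Suc k) r"
      using Suc.IH \<open>\<And>r. nbtail q k (Suc r) \<le> nbtail q k r\<close> order_trans by blast
    then have "q * nbtail q k (Suc r) \<le> q * nbtail q (Suc k) r"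
      using q by (intro mult_left_mono) auto
    then show ?case by (simp add: algebra_simps)
  qed auto
  have "nbtail q k (Suc r) \<le> nbtail q (Suc k) r"
    using Suc.IH mono order_trans by blast
  then have "(1 - q) * nbtail q k (Suc r) \<le> (1 - q) * nbtail q (Suc k) r"
    using q by (intro mult_left_mono) auto
  then show ?case by (simp add: algebra_simps)
qed auto

text \<open>The increments of \<open>\<lambda>v. nbtail q k (r - v)\<close>, so that tails become sums of nonnegative terms
  indexed by divisibility conditions.\<close>

definition nbjump :: "real \<Rightarrow> nat \<Rightarrow> nat \<Rightarrow> nat \<Rightarrow> real" where
  "nbjump q k r j =
     (if j = 0 then nbtail q k r else nbtail q k (r - j) - nbtail q k (Suc (r - j)))"

lemma nbjump_nonneg:
  assumes "0 \<le> q" "q \<le> 1"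
  shows "nbjump q k r j \<ge> 0"
  using nbtail_nonneg[OF assms] nbtail_Suc_le[OF assms] by (auto simp: nbjump_def)

lemma sum_nbjump:
  assumes "v \<le> r"
  shows "(\<Sum>j\<le>v. nbjump q k r j) = nbtail q k (r - v)"
  using assms
proof (induction v)
  case (Suc v)
  then have "Suc (r - Suc v) = r - v" by simp
  with Suc show ?case by (simp add: nbjump_def)
qed (simp add: nbjump_def)

text \<open>Adding one variable: condition on a geometric \<open>G\<close> with
  \<open>P(G \<ge> j) = q ^ j\<close> and sum by parts.\<close>

lemma sum_nbjump_powers: "(\<Sum>j\<le>r. nbjump q k r j * q ^ j) = nbtail q (Suc k) r"
proof (induction r)
  case (Suc r)
  \<comment> \<open>Raising \<open>r\<close> by one shifts the increments by one index; only index 0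
    differs, where \<open>nbjump\<close> holds a whole tail.\<close>
  have *: "nbjump q k (Suc r) (Suc j) =
      nbjump q k r j - (if j = 0 then nbtail q k (Suc r) else 0)" if "j \<le> r" for j
    by (auto simp: nbjump_def)
  have "(\<Sum>j\<le>Suc r. nbjump q k (Suc r) j * q ^ j) =
      nbtail q k (Suc r) + (\<Sum>j\<le>r. nbjump q k (Suc r) (Suc j) * q ^ Suc j)"
    by (subst sum.atMost_Suc_shift) (simp add: nbjump_def)
  also have "(\<Sum>j\<le>r. nbjump q k (Suc r) (Suc j) * q ^ Suc j) =
      (\<Sum>j\<le>r. q * (nbjump q k r j * q ^ j) - (if j = 0 then q * nbtail q k (Suc r) else 0))"
    by (rule sum.cong) (auto simp: * algebra_simps)
  also have "\<dots> = q * nbtail q (Suc k) r - q * nbtail q k (Suc r)"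
    by (simp add: sum_subtractf Suc.IH flip: sum_distrib_left)
  finally show ?case by (simp add: algebra_simps)
qed (simp add: nbjump_def)

section \<open>Upper bounds for the tails\<close>

text \<open>Each of the \<open>k ^ r\<close> assignments of \<open>r\<close> units to the
  \<open>k\<close> variables is realised with probability \<open>(1 / p) ^ r\<close>.\<close>

lemma nbtail_le_union_bound:
  assumes "p \<ge> (1::real)"
  shows "nbtail (1 / p) k r \<le> (real k / p) ^ r"
proof (induction k arbitrary: r)
  case (Suc k)
  note IH = Suc.IH
  show ?case
  proof (induction r)
    case (Suc r)
    have "nbtail (1 / p) (Suc k) (Suc r)
        \<le> (1 - 1 / p) * (real k / p) ^ Suc r + 1 / p * (real (Suc k) / p) ^ r"
      unfolding nbtail.simps using assms
      by (intro add_mono mult_left_mono IH Suc.IH) auto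
    also have "\<dots> \<le> 1 * (real k / p * (real (Suc k) / p) ^ r) + 1 / p * (real (Suc k) / p) ^ r"
      unfolding power_Suc using assms
      by (intro add_mono mult_mono power_mono divide_right_mono) auto
    also have "\<dots> = (real (Suc k) / p) ^ Suc r"
      using assms by (simp add: field_simps)
    finally show ?case .
  qed auto
qed auto

text \<open>Markov's inequality for \<open>t\<close> to the power of the sum;
  \<open>(1 - q) / (1 - q * t)\<close> is the generating function of one variable at
  \<open>t\<close>.\<close>

lemma nbtail_le_chernoff:
  assumes "0 \<le> q" "q \<le> 1" "1 \<le> t" "q * t < 1"
  shows "nbtail q k r \<le> ((1 - q) / (1 - q * t)) ^ k / t ^ r"
proof -
  define A where "A = (1 - q) / (1 - q * t)"
  have "q * 1 \<le> q * t" using assms by (intro mult_left_mono) auto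
  with assms have A: "A \<ge> 1" and q1: "q < 1" by (auto simp: A_def field_simps)
  have q: "1 - q = A * (1 - q * t)" using assms by (simp add: A_def)
  have "nbtail q k r \<le> A ^ k / t ^ r"
  proof (induction k arbitrary: r)
    case 0
    then show ?case using assms by auto
  next
    case (Suc k)
    note IH = Suc.IH
    show ?case
    proof (induction r)
      case 0
      then show ?case using A by (simp flip: power_Suc)
    next
      case (Suc r)
      have "nbtail q (Suc k) (Suc r)
          \<le> (1 - q) * (A ^ k / t ^ Suc r) + q * (A ^ Suc k / t ^ r)"
        unfolding nbtail.simps using assms
        by (intro add_mono mult_left_mono IH Suc.IH) auto
      also have "\<dots> = A ^ Suc k / t ^ Suc r"
        unfolding q using assms by (simp add: field_simps)
      finally show ?case .
    qed
  qed
  then show ?thesis by (simp add: A_def)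
qed

section \<open>Counting zeros\<close>

text \<open>Division by \<open>d\<close> is injective on \<open>S\<close>. The extra 1 is the source
  of the \<open>1/m\<close> lost per variable.\<close>

lemma card_congruent_le:
  fixes S :: "int set" and d m :: nat
  assumes "S \<subseteq> {0..<int m}" and "d > 0"
    and cong: "\<And>x y. x \<in> S \<Longrightarrow> y \<in> S \<Longrightarrow> int d dvd x - y"
  shows "real (card S) \<le> real m / real d + 1"
proof (cases "S = {}")
  case False
  have fin: "finite S" using assms(1) finite_subset by blast
  have "inj_on (\<lambda>x. x div int d) S"
  proof (rule inj_onI)
    fix x y assume "x \<in> S" "y \<in> S" "x div int d = y div int d"
    moreover from this have "x mod int d = y mod int d"
      using cong mod_eq_dvd_iff by blast
    ultimately show "x = y" by (metis div_mult_mod_eq)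
  qed
  then have "card S = card ((\<lambda>x. x div int d) ` S)" by (simp add: card_image)
  also have "\<dots> \<le> card {0..int m div int d}"
    using assms by (intro card_mono) (auto simp: zdiv_mono1 pos_imp_zdiv_nonneg_iff subset_iff)
  finally have "card S \<le> m div d + 1" by (simp add: nat_add_distrib flip: zdiv_int)
  then have "real (card S) \<le> real (m div d) + 1" by linarith
  also have "real (m div d) \<le> real m / real d" by (rule of_nat_div_le_of_nat)
  finally show ?thesis by simp
qed simp

lemma prod_primes_power_dvd:
  fixes x :: int
  assumes "finite P" "\<And>p. p \<in> P \<Longrightarrow> prime p" "\<And>p. p \<in> P \<Longrightarrow> int p ^ e p dvd x"
  shows "int (\<Prod>p\<in>P. p ^ e p) dvd x"
  using assms
proof (induction P rule: finite_induct)
  case (insert p P)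
  have "coprime (p ^ e p) (\<Prod>p\<in>P. p ^ e p)"
    using insert by (intro prod_coprime_right) (auto intro: primes_coprime)
  with insert show ?case by (auto intro!: divides_mult simp flip: coprime_int_iff)
qed simp

lemma ml_eval_Suc:
  "ml_eval (Suc k) c x = ml_eval k (\<lambda>S. c S + x k * c (insert k S)) x"
proof -
  have *: "Pow {..<Suc k} = Pow {..<k} \<union> insert k ` Pow {..<k}"
    by (simp add: lessThan_Suc Pow_insert)
  have inj: "inj_on (insert k) (Pow {..<k})"
    by (rule inj_onI) (auto simp: insert_ident subset_iff)
  have "(\<Sum>S\<in>Pow {..<Suc k}. c S * (\<Prod>i\<in>S. x i)) =
     (\<Sum>S\<in>Pow {..<k}. c S * (\<Prod>i\<in>S. x i)) + (\<Sum>S\<in>Pow {..<k}. c (insert k S) * (\<Prod>i\<in>insert k S. x i))"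
    unfolding * by (subst sum.union_disjoint) (auto simp: sum.reindex[OF inj])
  also have "(\<Sum>S\<in>Pow {..<k}. c (insert k S) * (\<Prod>i\<in>insert k S. x i)) =
     (\<Sum>S\<in>Pow {..<k}. x k * c (insert k S) * (\<Prod>i\<in>S. x i))"
  proof (rule sum.cong)
    fix S assume "S \<in> Pow {..<k}"
    then have "finite S" "k \<notin> S" using finite_subset by auto
    then show "c (insert k S) * (\<Prod>i\<in>insert k S. x i) = x k * c (insert k S) * (\<Prod>i\<in>S. x i)"
      by simp
  qed simp
  finally show ?thesis by (simp add: ml_eval_def sum.distrib algebra_simps)
qed

lemma ml_eval_cong:
  assumes "\<And>i. i < k \<Longrightarrow> x i = y i"
  shows "ml_eval k c x = ml_eval k c y"
  unfolding ml_eval_def using assms by (intro sum.cong prod.cong arg_cong2[of _ _ _ _ "(*)"]) auto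

lemma card_zeros_Suc_le:
  fixes R :: "int \<Rightarrow> bool"
  shows "card {x \<in> PiE {..<Suc k} (\<lambda>_. {0..<int m}). R (ml_eval (Suc k) c x)}
    \<le> (\<Sum>y\<in>{0..<int m}. card {x \<in> PiE {..<k} (\<lambda>_. {0..<int m}).
          R (ml_eval k (\<lambda>S. c S + y * c (insert k S)) x)})"
    (is "card ?Z \<le> (\<Sum>y\<in>_. card (?W y))")
proof -
  have fin: "finite (?W y)" for y
    by (rule finite_subset[OF _ finite_PiE[of "{..<k}" "\<lambda>_. {0..<int m}"]]) auto
  have "?Z \<subseteq> (\<lambda>(y, g). g(k := y)) ` (SIGMA y:{0..<int m}. ?W y)"
  proof
    fix x assume x: "x \<in> ?Z"
    then have "x \<in> (\<lambda>(y, g). g(k := y)) ` ({0..<int m} \<times> PiE {..<k} (\<lambda>_. {0..<int m}))"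
      by (simp add: lessThan_Suc PiE_insert_eq)
    then obtain y g where yg: "x = g(k := y)" "y \<in> {0..<int m}" "g \<in> PiE {..<k} (\<lambda>_. {0..<int m})"
      by auto
    have "ml_eval (Suc k) c x = ml_eval k (\<lambda>S. c S + y * c (insert k S)) g"
      unfolding ml_eval_Suc yg(1) by (auto intro: ml_eval_cong)
    with x yg show "x \<in> (\<lambda>(y, g). g(k := y)) ` (SIGMA y:{0..<int m}. ?W y)"
      by (intro image_eqI[of _ _ "(y, g)"]) auto
  qed
  then have "card ?Z \<le> card ((\<lambda>(y, g). g(k := y)) ` (SIGMA y:{0..<int m}. ?W y))"
    using fin by (intro card_mono finite_imageI finite_SigmaI) auto
  also have "\<dots> \<le> card (SIGMA y:{0..<int m}. ?W y)"
    using fin by (intro card_image_le finite_SigmaI) auto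
  also have "\<dots> = (\<Sum>y\<in>{0..<int m}. card (?W y))"
    using fin by (intro card_SigmaI) auto
  finally show ?thesis .
qed

text \<open>Read \<open>v y p\<close> as the gain in \<open>p\<close>-adic valuation when
  \<open>y\<close> is substituted. Once the tails are expanded into increments, each exponent vector
  \<open>e\<close> asks for the number of \<open>y\<close> whose gains are all at least
  \<open>e p\<close>; these lie in one class modulo the product of the
  \<open>p ^ e p\<close>.\<close>

lemma sum_prod_nbtail_le:
  fixes P :: "nat set" and r :: "nat \<Rightarrow> nat" and v :: "int \<Rightarrow> nat \<Rightarrow> nat"
  assumes P: "finite P" "\<And>p. p \<in> P \<Longrightarrow> prime p"
    and v_le: "\<And>y p. p \<in> P \<Longrightarrow> v y p \<le> r p"
    and v_dvd: "\<And>y y' p e. p \<in> P \<Longrightarrow> e \<le> v y p \<Longrightarrow> e \<le> v y' p \<Longrightarrow> int p ^ e dvd y - y'"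
  shows "(\<Sum>y\<in>{0..<int m}. \<Prod>p\<in>P. nbtail (1 / real p) k (r p - v y p))
    \<le> real m * (\<Prod>p\<in>P. nbtail (1 / real p) (Suc k) (r p)) + 1"
proof -
  define J where "J p j = nbjump (1 / real p) k (r p) j" for p j
  define E where "E = PiE P (\<lambda>p. {..r p})"
  have J: "J p j \<ge> 0" if "p \<in> P" for p j
    unfolding J_def using P(2)[OF that] by (intro nbjump_nonneg) (auto simp: Suc_leI prime_gt_0_nat)
  have "(\<Prod>p\<in>P. nbtail (1 / real p) k (r p - v y p)) =
      (\<Sum>e\<in>E. (\<Prod>p\<in>P. J p (e p)) * of_bool (\<forall>p\<in>P. e p \<le> v y p))" for y
  proof -
    have "(\<Prod>p\<in>P. nbtail (1 / real p) k (r p - v y p)) =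
        (\<Prod>p\<in>P. \<Sum>j\<le>r p. J p j * of_bool (j \<le> v y p))"
    proof (rule prod.cong)
      fix p assume p: "p \<in> P"
      have "nbtail (1 / real p) k (r p - v y p) = (\<Sum>j\<le>v y p. J p j)"
        using v_le[OF p] by (simp add: J_def sum_nbjump)
      also have "\<dots> = (\<Sum>j\<le>r p. J p j * of_bool (j \<le> v y p))"
        using v_le[OF p, of y] by (intro sum.mono_neutral_cong_left) auto
      finally show "nbtail (1 / real p) k (r p - v y p) = \<dots>" .
    qed simp
    also have "\<dots> = (\<Sum>e\<in>E. \<Prod>p\<in>P. J p (e p) * of_bool (e p \<le> v y p))"
      unfolding E_def using P by (intro prod_sum_PiE) auto
    also have "\<dots> = (\<Sum>e\<in>E. (\<Prod>p\<in>P. J p (e p)) * of_bool (\<forall>p\<in>P. e p \<le> v y p))"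
      using P(1) by (intro sum.cong) (auto simp: prod.distrib)
    finally show ?thesis .
  qed
  then have "(\<Sum>y\<in>{0..<int m}. \<Prod>p\<in>P. nbtail (1 / real p) k (r p - v y p)) =
      (\<Sum>y\<in>{0..<int m}. \<Sum>e\<in>E. (\<Prod>p\<in>P. J p (e p)) * of_bool (\<forall>p\<in>P. e p \<le> v y p))"
    by simp
  also have "\<dots> = (\<Sum>e\<in>E. (\<Prod>p\<in>P. J p (e p)) * real (card {y\<in>{0..<int m}. \<forall>p\<in>P. e p \<le> v y p}))"
    by (subst sum.swap) (simp add: Int_def flip: sum_distrib_left)
  also have "\<dots> \<le> (\<Sum>e\<in>E. (\<Prod>p\<in>P. J p (e p)) * (real m / real (\<Prod>p\<in>P. p ^ e p) + 1))"
  proof (intro sum_mono mult_left_mono card_congruent_le prod_nonneg J)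
    fix e
    show "0 < (\<Prod>p\<in>P. p ^ e p)"
      using P by (intro prod_pos) (auto simp: prime_gt_0_nat)
    fix y y'
    assume "y \<in> {y\<in>{0..<int m}. \<forall>p\<in>P. e p \<le> v y p}" "y' \<in> {y\<in>{0..<int m}. \<forall>p\<in>P. e p \<le> v y p}"
    then show "int (\<Prod>p\<in>P. p ^ e p) dvd y - y'"
      using P v_dvd by (intro prod_primes_power_dvd) auto
  qed auto
  also have "\<dots> = real m * (\<Sum>e\<in>E. \<Prod>p\<in>P. J p (e p) * (1 / real p) ^ e p) + (\<Sum>e\<in>E. \<Prod>p\<in>P. J p (e p))"
    by (simp add: algebra_simps sum.distrib sum_distrib_left prod_dividef power_divide)
  also have "(\<Sum>e\<in>E. \<Prod>p\<in>P. J p (e p) * (1 / real p) ^ e p) =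
      (\<Prod>p\<in>P. \<Sum>j\<le>r p. J p j * (1 / real p) ^ j)"
    unfolding E_def using P by (subst prod_sum_PiE) auto
  also have "\<dots> = (\<Prod>p\<in>P. nbtail (1 / real p) (Suc k) (r p))"
    unfolding J_def by (simp only: sum_nbjump_powers)
  \<comment> \<open>The rounding errors have as total weight a product of tails at 0, so they cost 1
    however many vectors \<open>e\<close> there are.\<close>
  also have "(\<Sum>e\<in>E. \<Prod>p\<in>P. J p (e p)) = (\<Prod>p\<in>P. \<Sum>j\<le>r p. J p j)"
    unfolding E_def using P by (subst prod_sum_PiE) auto
  also have "\<dots> = 1"
    unfolding J_def by (simp add: sum_nbjump)
  finally show ?thesis .
qed

section \<open>Growth of the content under substitution\<close>

text \<open>If some coefficient involving variable \<open>k\<close> is not divisible by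
  \<open>p ^ Suc s\<close>, subtraction isolates \<open>(y - y') * c (insert k S)\<close>. Otherwise
  some coefficient without it is not, and it stays so after substituting \<open>y\<close>, against
  \<open>e > 0\<close>.\<close>

lemma substitution_dvd_diff:
  fixes c :: "nat set \<Rightarrow> int" and p :: nat
  assumes "prime p"
    and prim: "\<exists>S\<subseteq>{..<Suc k}. \<not> int p ^ Suc s dvd c S"
    and "e > 0"
    and y: "\<forall>S\<subseteq>{..<k}. int p ^ (s + e) dvd c S + y * c (insert k S)"
    and y': "\<forall>S\<subseteq>{..<k}. int p ^ (s + e) dvd c S + y' * c (insert k S)"
  shows "int p ^ e dvd y - y'"
proof (cases "\<forall>S\<subseteq>{..<k}. int p ^ Suc s dvd c (insert k S)")
  case True
  obtain S where S: "S \<subseteq> {..<Suc k}" "\<not> int p ^ Suc s dvd c S" using prim by blast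
  show ?thesis
  proof (cases "k \<in> S")
    case True
    have "S - {k} \<subseteq> {..<k}" using S(1) by (auto simp: less_Suc_eq)
    then have "int p ^ Suc s dvd c (insert k (S - {k}))"
      using \<open>\<forall>S\<subseteq>{..<k}. int p ^ Suc s dvd c (insert k S)\<close> by blast
    with True S(2) show ?thesis by (simp add: insert_absorb)
  next
    case False
    then have S': "S \<subseteq> {..<k}" using S(1) by (auto simp: less_Suc_eq)
    have "int p ^ Suc s dvd int p ^ (s + e)"
      using \<open>e > 0\<close> by (intro le_imp_power_dvd) auto
    then have "int p ^ Suc s dvd c S + y * c (insert k S)"
      using y S' dvd_trans by blast
    moreover have "int p ^ Suc s dvd y * c (insert k S)"
      using True S' by (intro dvd_mult) auto
    ultimately show ?thesis using S(2) by (simp only: dvd_add_left_iff)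
  qed
next
  case False
  then obtain S where S: "S \<subseteq> {..<k}" "\<not> int p ^ Suc s dvd c (insert k S)" by blast
  have "int p ^ (s + e) dvd (c S + y * c (insert k S)) - (c S + y' * c (insert k S))"
    using y y' S(1) by (intro dvd_diff) auto
  then have "int p ^ (s + e) dvd (y - y') * c (insert k S)"
    by (simp add: algebra_simps)
  moreover have "prime_elem (int p)" using assms(1) by auto
  \<comment> \<open>The exponents \<open>e\<close> and \<open>Suc s\<close> add up to one more than
    \<open>s + e\<close>, so one of the two factors must contain its share.\<close>
  ultimately show ?thesis
    using prime_elem_power_dvd_cases[of "int p" "s + e" "y - y'" "c (insert k S)" e "Suc s"] S(2)
    by auto
qed

text \<open>The exponent \<open>s p\<close> stands for a power of \<open>p\<close> already present in the coefficients, which avoids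
  dividing the polynomial by its content during the induction.\<close>

lemma card_zeros_le:
  fixes P :: "nat set" and r s :: "nat \<Rightarrow> nat" and c :: "nat set \<Rightarrow> int"
  assumes P: "finite P" "\<And>p. p \<in> P \<Longrightarrow> prime p" and m: "m > 0"
    and "\<And>p. p \<in> P \<Longrightarrow> r p > 0 \<Longrightarrow> \<exists>S\<subseteq>{..<k}. \<not> int p ^ Suc (s p) dvd c S"
  shows "real (card {x \<in> PiE {..<k} (\<lambda>_. {0..<int m}).
             \<forall>p\<in>P. int p ^ (s p + r p) dvd ml_eval k c x})
    \<le> real m ^ k * (real k / real m + (\<Prod>p\<in>P. nbtail (1 / real p) k (r p)))"
  using assms(4)
proof (induction k arbitrary: c r s)
  case 0
  let ?Z = "{x \<in> PiE {..<0::nat} (\<lambda>_. {0..<int m}). \<forall>p\<in>P. int p ^ (s p + r p) dvd ml_eval 0 c x}"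
  show ?case
  proof (cases "\<exists>p\<in>P. r p > 0")
    case True
    then obtain p where p: "p \<in> P" "r p > 0" by blast
    have "int p ^ Suc (s p) dvd int p ^ (s p + r p)"
      using p by (intro le_imp_power_dvd) auto
    moreover have "\<not> int p ^ Suc (s p) dvd ml_eval 0 c x" for x
      using 0[OF p] by (auto simp: ml_eval_def)
    ultimately have empty: "?Z = {}" using p dvd_trans by blast
    have "(\<Prod>p\<in>P. nbtail (1 / real p) 0 (r p)) \<ge> 0"
      by (intro prod_nonneg) auto
    then show ?thesis unfolding empty by simp
  next
    case False
    have "card ?Z \<le> card {\<lambda>_::nat. undefined :: int}"
      by (intro card_mono) auto
    with False show ?thesis by simp
  qed
next
  case (Suc k)
  define D where "D y S = c S + y * c (insert k S)" for y S
  define G where "G y p = {j. j \<le> r p \<and> (j = 0 \<or> (\<forall>S\<subseteq>{..<k}. int p ^ (s p + j) dvd D y S))}" for y p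
  define v where "v y p = Max (G y p)" for y p
  define F where "F y = {x \<in> PiE {..<k} (\<lambda>_. {0..<int m}). \<forall>p\<in>P. int p ^ (s p + r p) dvd ml_eval k (D y) x}" for y
  have fin: "finite (G y p)" for y p by (auto simp: G_def)
  have "0 \<in> G y p" for y p by (auto simp: G_def)
  then have v: "v y p \<in> G y p" for y p
    unfolding v_def using fin[of y p] by (intro Max_in) auto
  have v_max: "j \<le> v y p" if "j \<in> G y p" for j y p
    unfolding v_def using fin that by (intro Max_ge) auto
  have v_le: "v y p \<le> r p" for y p using v by (auto simp: G_def)
  have v_dvd: "int p ^ e dvd y - y'" if "p \<in> P" "e \<le> v y p" "e \<le> v y' p" for y y' p e
  proof (cases "e = 0")
    case False
    have D: "\<forall>S\<subseteq>{..<k}. int p ^ (s p + e) dvd D z S" if "e \<le> v z p" for z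
    proof (intro allI impI)
      fix S assume S: "S \<subseteq> {..<k}"
      have "int p ^ (s p + e) dvd int p ^ (s p + v z p)"
        using that by (intro le_imp_power_dvd) auto
      also have "\<dots> dvd D z S"
        using v[of z p] False that S by (auto simp: G_def)
      finally show "int p ^ (s p + e) dvd D z S" .
    qed
    have "r p > 0" using v_le[of y p] that(2) False by linarith
    with Suc.prems[OF that(1)] have "\<exists>S\<subseteq>{..<Suc k}. \<not> int p ^ Suc (s p) dvd c S" by blast
    then show ?thesis
      using D[OF that(2)] D[OF that(3)] P(2)[OF that(1)] False
      unfolding D_def by (intro substitution_dvd_diff) auto
  qed simp
  have F: "real (card (F y))
      \<le> real m ^ k * (real k / real m + (\<Prod>p\<in>P. nbtail (1 / real p) k (r p - v y p)))" for y
  proof -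
    have "F y = {x \<in> PiE {..<k} (\<lambda>_. {0..<int m}).
        \<forall>p\<in>P. int p ^ ((s p + v y p) + (r p - v y p)) dvd ml_eval k (D y) x}"
      using v_le by (simp add: F_def)
    \<comment> \<open>Below the cap \<open>r p\<close>, maximality of \<open>v y p\<close> is
      exactly the premise of the induction hypothesis for the new base exponent.\<close>
    moreover have "\<exists>S\<subseteq>{..<k}. \<not> int p ^ Suc (s p + v y p) dvd D y S" if "r p - v y p > 0" for p
      using that v_max[of "Suc (v y p)" y p] by (auto simp: G_def)
    ultimately show ?thesis
      using Suc.IH[of "\<lambda>p. r p - v y p" "\<lambda>p. s p + v y p" "D y"] by simp
  qed
  have "real (card {x \<in> PiE {..<Suc k} (\<lambda>_. {0..<int m}).
      \<forall>p\<in>P. int p ^ (s p + r p) dvd ml_eval (Suc k) c x}) \<le> real (\<Sum>y\<in>{0..<int m}. card (F y))"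
    unfolding F_def D_def of_nat_le_iff
    by (rule card_zeros_Suc_le[where R = "\<lambda>z. \<forall>p\<in>P. int p ^ (s p + r p) dvd z"])
  also have "\<dots> = (\<Sum>y\<in>{0..<int m}. real (card (F y)))" by simp
  also have "\<dots> \<le> (\<Sum>y\<in>{0..<int m}. real m ^ k *
      (real k / real m + (\<Prod>p\<in>P. nbtail (1 / real p) k (r p - v y p))))"
    by (intro sum_mono F)
  also have "\<dots> = real m ^ k *
      (real k + (\<Sum>y\<in>{0..<int m}. \<Prod>p\<in>P. nbtail (1 / real p) k (r p - v y p)))"
    using m by (simp add: sum.distrib flip: sum_distrib_left)
  also have "\<dots> \<le> real m ^ k *
      (real k + (real m * (\<Prod>p\<in>P. nbtail (1 / real p) (Suc k) (r p)) + 1))"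
    using P v_le v_dvd by (intro mult_left_mono add_left_mono sum_prod_nbtail_le) auto
  also have "\<dots> = real m ^ Suc k *
      (real (Suc k) / real m + (\<Prod>p\<in>P. nbtail (1 / real p) (Suc k) (r p)))"
    using m by (simp add: field_simps)
  finally show ?case .
qed

section \<open>The product of the tails\<close>

text \<open>Weighted AM-GM for \<open>p\<close> and 1. It will bound the Chernoff factor at
  \<open>t = p powr s\<close> by \<open>1 / (1 - s)\<close>.\<close>

lemma generating_factor_bound:
  fixes p s :: real
  assumes "p \<ge> 1" "0 \<le> s" "s \<le> 1"
  shows "(1 - s) * (1 - 1 / p) \<le> 1 - 1 / p * p powr s"
proof -
  have "p powr s \<le> s * p + (1 - s)"
    using Youngs_inequality_0[of s "1 - s" p 1] assms by simp
  then have "1 / p * p powr s \<le> 1 / p * (s * p + (1 - s))"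
    using assms by (intro mult_left_mono) auto
  also have "\<dots> = 1 - (1 - s) * (1 - 1 / p)"
    using assms by (simp add: field_simps)
  finally show ?thesis by simp
qed

lemma card_positive_less:
  fixes X :: real
  assumes "X \<ge> 0" "0 \<notin> P"
  shows "real (card {p \<in> P. real p < X}) \<le> X"
proof -
  have "{p \<in> P. real p < X} \<subseteq> {1..nat \<lfloor>X\<rfloor>}"
    using assms by (auto simp: le_nat_floor Suc_le_eq intro!: gr0I)
  then have "card {p \<in> P. real p < X} \<le> card {1..nat \<lfloor>X\<rfloor>}"
    by (intro card_mono) auto
  then have "real (card {p \<in> P. real p < X}) \<le> real (nat \<lfloor>X\<rfloor>)" by simp
  also have "\<dots> \<le> X" using assms by simp
  finally show ?thesis .
qed

text \<open>With \<open>u = 1 + \<epsilon>\<close> the right side is \<open>4 * s\<close>. Passing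
  to the square root makes the linear bound on \<open>ln\<close> strong enough up to
  \<open>u = 4\<close>.\<close>

lemma log2_le_four_times:
  fixes u :: real
  assumes "1 \<le> u" "u \<le> 4"
  shows "log 2 u \<le> 4 * ((u - 1) / u)"
proof -
  define w where "w = sqrt u"
  have w: "1 \<le> w" "w \<le> 2" and u: "u = w\<^sup>2"
    using assms by (auto simp: w_def real_le_lsqrt)
  have "ln u = 2 * ln w" unfolding u using w by (simp add: ln_realpow)
  also have "\<dots> \<le> 2 * (w - 1)" using w ln_le_minus_one[of w] by simp
  also have "\<dots> \<le> (8 / 3) * ((w - 1) * ((w + 1) / w\<^sup>2))"
  proof -
    \<comment> \<open>The product is \<open>3 * w\<^sup>2 - 4 * w - 4\<close>, so the next bound is
      sharp at \<open>w = 2\<close>.\<close>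
    have "(w - 2) * (3 * w + 2) \<le> 0" using w by (intro mult_nonpos_nonneg) auto
    then have "3 / 4 \<le> (w + 1) / w\<^sup>2"
      using w by (simp add: field_simps power2_eq_square)
    then have "(w - 1) * (3 / 4) \<le> (w - 1) * ((w + 1) / w\<^sup>2)"
      using w by (intro mult_left_mono) auto
    then show ?thesis by simp
  qed
  also have "\<dots> = (2 / 3) * (4 * ((u - 1) / u))"
    unfolding u using w by (simp add: field_simps power2_eq_square)
  also have "\<dots> \<le> ln 2 * (4 * ((u - 1) / u))"
    using ln2_ge_two_thirds assms by (intro mult_right_mono) auto
  finally show ?thesis by (simp add: log_def divide_le_eq mult.commute)
qed

text \<open>With \<open>u = 1 + \<epsilon>\<close> the right side is at most \<open>sqrt B\<close>,
  which controls the primes below \<open>sqrt B\<close>. The proof is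
  \<open>log 2 u = 1 + log 2 z \<le> 1 + z \<le> 2 powr z\<close> for
  \<open>z = u / 2\<close>.\<close>

lemma log2_le_two_powr_half:
  fixes u :: real
  assumes "u \<ge> 2"
  shows "log 2 u \<le> 2 powr (u / 2)"
proof -
  define z where "z = u / 2"
  have z: "z \<ge> 1" "u = 2 * z" using assms by (auto simp: z_def)
  have "ln (1 + z) = ln 2 + ln ((1 + z) / 2)"
    using z by (simp add: ln_div)
  also have "\<dots> \<le> ln 2 + ((1 + z) / 2 - 1)"
    using z by (intro add_left_mono ln_le_minus_one) auto
  also have "\<dots> = ln 2 + (z - 1) * (1 / 2)" by (simp add: field_simps)
  also have "\<dots> \<le> ln 2 + (z - 1) * ln 2"
    using z ln2_ge_two_thirds by (intro add_left_mono mult_left_mono) auto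
  also have "\<dots> = ln (2 powr z)" by (simp add: ln_powr algebra_simps)
  finally have *: "1 + z \<le> 2 powr z"
    by (subst (asm) ln_le_cancel_iff) (use z in auto)
  then have "log 2 z \<le> z" using z by (simp add: log_le_iff)
  moreover have "log 2 u = 1 + log 2 z" using z by (simp add: log_mult)
  ultimately show ?thesis using * z_def by simp
qed

section \<open>Estimates in terms of \<open>\<mu>\<close> and \<open>\<epsilon>\<close>\<close>

locale parameters =
  fixes \<mu> :: nat and \<epsilon> :: real
  assumes \<mu>: "\<mu> \<ge> 2" and \<epsilon>: "\<epsilon> \<ge> log (real \<mu>) 2"
begin

text \<open>The point at which \<open>\<mu> / p\<close> equals \<open>p powr (- s)\<close>.\<close>

definition B :: real where "B = real \<mu> powr (1 + \<epsilon>)"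
text \<open>Chosen so that \<open>s * (1 + 1 / \<epsilon>) = 1\<close>.\<close>

definition s :: real where "s = \<epsilon> / (1 + \<epsilon>)"

text \<open>\<open>loss p\<close> bounds the binary logarithm of the Chernoff factor
  \<open>(1 - 1/p) / (1 - p powr (s - 1))\<close>. The factor is at most \<open>1/(1 - s) = 1 + \<epsilon>\<close>, and at most
  \<open>4\<close> beyond \<open>sqrt B\<close>; the second bound is needed only when \<open>\<epsilon>\<close> is large.\<close>

definition loss :: "nat \<Rightarrow> real" where
  "loss p = (if real p \<ge> B then 0
     else if \<epsilon> \<le> 3 \<or> real p < sqrt B then log 2 (1 + \<epsilon>) else 2)"

lemma eps_pos: "\<epsilon> > 0"
proof -
  have "log (real \<mu>) 2 > 0" using \<mu> by simp
  with \<epsilon> show ?thesis by linarith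
qed

lemma s: "0 < s" "s < 1" "1 - s = 1 / (1 + \<epsilon>)"
  using eps_pos by (auto simp: s_def field_simps)

lemma B_powr: "B powr (1 - s) = real \<mu>"
  using \<mu> eps_pos by (simp add: B_def s(3) powr_powr)

lemma B_ge: "2 powr (1 + \<epsilon>) \<le> B"
  unfolding B_def using \<mu> eps_pos by (intro powr_mono2) auto

lemma nbtail_le_loss:
  assumes "p \<ge> 2"
  shows "nbtail (1 / real p) \<mu> r \<le> 2 powr (real \<mu> * loss p) * (real p ^ r) powr (- s)"
proof (cases "real p \<ge> B")
  case True
  have "nbtail (1 / real p) \<mu> r \<le> (real \<mu> / real p) ^ r"
    using assms by (intro nbtail_le_union_bound) auto
  also have "\<dots> \<le> (real p powr (- s)) ^ r"
  proof (rule power_mono)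
    have "real \<mu> \<le> real p powr (1 - s)"
      unfolding B_powr[symmetric] using True s eps_pos by (intro powr_mono2) (auto simp: B_def)
    also have "\<dots> = real p powr (- s) * real p"
      using assms by (simp add: powr_diff powr_minus field_simps)
    finally show "real \<mu> / real p \<le> real p powr (- s)"
      using assms by (simp add: divide_le_eq)
  qed auto
  also have "\<dots> = (real p ^ r) powr (- s)"
    using assms by (simp add: powr_power powr_powr mult.commute flip: powr_realpow)
  finally show ?thesis using True by (simp add: loss_def)
next
  case False
  define A where "A = (1 - 1 / real p) / (1 - 1 / real p * real p powr s)"
  have q: "0 < 1 - 1 / real p" using assms by simp
  have *: "(1 - s) * (1 - 1 / real p) \<le> 1 - 1 / real p * real p powr s"
    using assms s by (intro generating_factor_bound) auto
  moreover have "0 < (1 - s) * (1 - 1 / real p)"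
    using s(2) q by (intro mult_pos_pos) auto
  ultimately have pos: "0 < 1 - 1 / real p * real p powr s" by linarith
  have A0: "A > 0" using q pos by (simp add: A_def)
  have "A \<le> 1 / (1 - s)"
  proof -
    have "1 - 1 / real p \<le> (1 - 1 / real p * real p powr s) / (1 - s)"
      using * s(2) by (subst pos_le_divide_eq) (auto simp: mult.commute)
    then show ?thesis
      unfolding A_def using pos by (subst pos_divide_le_eq) auto
  qed
  then have A1: "A \<le> 1 + \<epsilon>" by (simp add: s(3))
  \<comment> \<open>Here \<open>p powr (s - 1)\<close> is at most \<open>1 / sqrt \<mu>\<close>,
    hence at most \<open>3 / 4\<close>, and the denominator of \<open>A\<close> is at least
    \<open>1 / 4\<close>.\<close>
  have A2: "A \<le> 4" if "real p \<ge> sqrt B"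
  proof -
    have "1 / real p * real p powr s = real p powr (- (1 - s))"
      using assms by (simp add: powr_diff powr_minus field_simps)
    also have "\<dots> \<le> sqrt B powr (- (1 - s))"
      using that s \<mu> eps_pos by (intro powr_mono2') (auto simp: B_def)
    also have "\<dots> = (B powr (1 - s)) powr (- (1 / 2))"
    proof -
      have "0 \<le> B" by (simp add: B_def)
      then have "sqrt B = B powr (1 / 2)" by (simp add: powr_half_sqrt)
      then show ?thesis by (simp only: powr_powr mult_minus_right mult_minus_left mult.commute)
    qed
    also have "\<dots> = real \<mu> powr (- (1 / 2))" by (simp add: B_powr)
    also have "\<dots> \<le> 2 powr (- (1 / 2))" using \<mu> by (intro powr_mono2') auto
    also have "\<dots> = 1 / sqrt 2" by (simp add: powr_minus powr_half_sqrt field_simps)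
    also have "\<dots> \<le> 3 / 4"
      using real_le_rsqrt[of "4 / 3" 2] by (simp add: field_simps power2_eq_square)
    finally have "1 / 4 \<le> 1 - 1 / real p * real p powr s" by simp
    then have "4 * (1 / 4) \<le> 4 * (1 - 1 / real p * real p powr s)"
      by (intro mult_left_mono) auto
    moreover have "1 - 1 / real p \<le> 4 * (1 / 4)" by simp
    ultimately have "1 - 1 / real p \<le> 4 * (1 - 1 / real p * real p powr s)"
      by (rule order_trans[rotated])
    then show ?thesis unfolding A_def by (subst pos_divide_le_eq[OF pos])
  qed
  have "A \<le> 2 powr loss p"
    using A1 A2 eps_pos False by (auto simp: loss_def)
  then have "A ^ \<mu> \<le> (2 powr loss p) ^ \<mu>" using A0 by (intro power_mono) auto
  also have "\<dots> = 2 powr (real \<mu> * loss p)" by (simp add: powr_power mult.commute)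
  finally have A: "A ^ \<mu> \<le> 2 powr (real \<mu> * loss p)" .
  \<comment> \<open>Taking \<open>t = p powr s\<close> makes \<open>1 / t ^ r\<close> the desired
    decay.\<close>
  have "nbtail (1 / real p) \<mu> r \<le> A ^ \<mu> / (real p powr s) ^ r"
    unfolding A_def using assms pos s by (intro nbtail_le_chernoff) (auto simp: ge_one_powr_ge_zero)
  also have "(real p powr s) ^ r = (real p ^ r) powr s"
    using assms by (simp add: powr_power powr_powr mult.commute flip: powr_realpow)
  also have "A ^ \<mu> / (real p ^ r) powr s = A ^ \<mu> * (real p ^ r) powr (- s)"
    by (simp add: powr_minus divide_inverse)
  also have "\<dots> \<le> 2 powr (real \<mu> * loss p) * (real p ^ r) powr (- s)"
    using A by (intro mult_right_mono) auto
  finally show ?thesis .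
qed

lemma sum_loss_le:
  assumes "finite P" "0 \<notin> P"
  shows "(\<Sum>p\<in>P. loss p) \<le> 4 * s * B"
proof -
  define C where "C X = real (card {p \<in> P. real p < X})" for X
  have C: "C X = (\<Sum>p\<in>P. of_bool (real p < X))" for X
    using assms(1) by (simp add: C_def Int_def)
  have C_le: "C X \<le> X" if "X \<ge> 0" for X
    using card_positive_less[OF that assms(2)] by (simp add: C_def)
  have B: "B > 0" using \<mu> by (simp add: B_def)
  have L: "log 2 (1 + \<epsilon>) \<ge> 0" using eps_pos by simp
  show ?thesis
  proof (cases "\<epsilon> \<le> 3")
    case True
    then have "(\<Sum>p\<in>P. loss p) = log 2 (1 + \<epsilon>) * C B"
      unfolding C sum_distrib_left by (intro sum.cong) (auto simp: loss_def)
    also have "\<dots> \<le> 4 * s * B"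
      using True eps_pos C_le[of B] B log2_le_four_times[of "1 + \<epsilon>"] L
      by (intro mult_mono) (auto simp: s_def C_def)
    finally show ?thesis .
  next
    case False
    have "(\<Sum>p\<in>P. loss p) \<le> (\<Sum>p\<in>P. log 2 (1 + \<epsilon>) * of_bool (real p < sqrt B) + 2 * of_bool (real p < B))"
      using L False by (intro sum_mono) (auto simp: loss_def)
    also have "\<dots> = log 2 (1 + \<epsilon>) * C (sqrt B) + 2 * C B"
      unfolding C by (simp add: sum.distrib sum_distrib_left)
    \<comment> \<open>Fewer than or equal to \<open>sqrt B\<close> elements cost at most
      \<open>sqrt B\<close> each, and at most \<open>B\<close> elements cost 2 each.\<close>
    also have "\<dots> \<le> sqrt B * sqrt B + 2 * B"
    proof -
      have "log 2 (1 + \<epsilon>) \<le> 2 powr ((1 + \<epsilon>) / 2)"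
        using False by (intro log2_le_two_powr_half) auto
      also have "\<dots> = sqrt (2 powr (1 + \<epsilon>))"
        by (simp add: powr_powr flip: powr_half_sqrt)
      also have "\<dots> \<le> sqrt B" using B_ge by simp
      finally show ?thesis
        using C_le[of "sqrt B"] C_le[of B] B by (intro add_mono mult_mono) (auto simp: C_def)
    qed
    also have "\<dots> = 3 * B" using B by simp
    \<comment> \<open>For \<open>\<epsilon> > 3\<close> one has
      \<open>s \<ge> 3 / 4\<close>.\<close>
    also have "\<dots> \<le> 4 * s * B"
      using B False by (intro mult_right_mono) (auto simp: s_def field_simps)
    finally show ?thesis .
  qed
qed

text \<open>In binary logarithms the losses total at most
  \<open>s * 4 * \<mu> powr (2 + \<epsilon>)\<close>; \<open>s\<close> times the hypothesis on
  \<open>N\<close> cancels this and leaves exactly \<open>lam\<close>.\<close>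

lemma prod_nbtail_le:
  fixes N :: nat and lam :: real
  assumes N: "N > 0"
    and log_N: "log 2 (real N) \<ge> 4 * real \<mu> powr (2 + \<epsilon>) + (1 + 1 / \<epsilon>) * lam"
  shows "(\<Prod>p\<in>prime_factors N. nbtail (1 / real p) \<mu> (multiplicity p N)) \<le> 2 powr (- lam)"
proof -
  let ?P = "prime_factors N"
  have p2: "p \<ge> 2" if "p \<in> ?P" for p
    using that by (auto simp: in_prime_factors_iff prime_ge_2_nat)
  have "(\<Prod>p\<in>?P. nbtail (1 / real p) \<mu> (multiplicity p N))
      \<le> (\<Prod>p\<in>?P. 2 powr (real \<mu> * loss p) * (real p ^ multiplicity p N) powr (- s))"
    using p2 by (intro prod_mono conjI nbtail_nonneg nbtail_le_loss) (auto simp: Suc_leI dest: p2)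
  also have "\<dots> = (\<Prod>p\<in>?P. 2 powr (real \<mu> * loss p)) * (\<Prod>p\<in>?P. real p ^ multiplicity p N) powr (- s)"
    by (simp add: prod.distrib prod_powr_distrib)
  also have "(\<Prod>p\<in>?P. 2 powr (real \<mu> * loss p)) = 2 powr (real \<mu> * (\<Sum>p\<in>?P. loss p))"
    by (simp add: powr_sum sum_distrib_left)
  also have "(\<Prod>p\<in>?P. real p ^ multiplicity p N) = real (\<Prod>p\<in>?P. p ^ multiplicity p N)"
    by simp
  also have "\<dots> = real N"
    using N by (subst prime_factorization_nat[symmetric]) auto
  also have "real N powr (- s) = 2 powr (- s * log 2 (real N))"
    using N by (simp add: powr_def log_def)
  also have "2 powr (real \<mu> * (\<Sum>p\<in>?P. loss p)) * \<dots> =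
      2 powr (real \<mu> * (\<Sum>p\<in>?P. loss p) - s * log 2 (real N))"
    by (simp flip: powr_add)
  also have "\<dots> \<le> 2 powr (- lam)"
  proof (rule powr_mono)
    have "0 \<notin> ?P" by auto
    then have "real \<mu> * (\<Sum>p\<in>?P. loss p) \<le> real \<mu> * (4 * s * B)"
      by (intro mult_left_mono sum_loss_le) auto
    also have "\<dots> = s * (4 * real \<mu> powr (2 + \<epsilon>))"
    proof -
      have "real \<mu> powr (2 + \<epsilon>) = real \<mu> powr (1 + (1 + \<epsilon>))" by simp
      also have "\<dots> = real \<mu> * B" using \<mu> unfolding B_def by (subst powr_add) auto
      finally show ?thesis by simp
    qed
    finally have "real \<mu> * (\<Sum>p\<in>?P. loss p) \<le> s * (4 * real \<mu> powr (2 + \<epsilon>))" .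
    moreover have "s * (4 * real \<mu> powr (2 + \<epsilon>) + (1 + 1 / \<epsilon>) * lam) \<le> s * log 2 (real N)"
      using log_N s by (intro mult_left_mono) auto
    moreover have "s * (1 + 1 / \<epsilon>) = 1"
      using eps_pos add_pos_pos[of \<epsilon> "\<epsilon> * \<epsilon>"] by (auto simp: s_def field_simps)
    then have "s * ((1 + 1 / \<epsilon>) * lam) = lam"
      by (simp flip: mult.assoc)
    ultimately show "real \<mu> * (\<Sum>p\<in>?P. loss p) - s * log 2 (real N) \<le> - lam"
      by (simp add: distrib_left)
  qed simp
  finally show ?thesis .
qed

end

section \<open>From prime powers to \<open>N\<close>\<close>

lemma coprime_to_prime_factor:
  assumes "coprime_to k c (int N)" and p: "p \<in> prime_factors N"
  shows "\<exists>S\<subseteq>{..<k}. \<not> int p dvd c S"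
proof (rule ccontr)
  assume *: "\<not> ?thesis"
  have "int p dvd Gcd (insert (int N) (c ` Pow {..<k}))"
    using * p by (intro Gcd_greatest) (auto simp: in_prime_factors_iff)
  with assms show False
    by (auto simp: coprime_to_def in_prime_factors_iff)
qed

theorem theorem2:
  fixes \<mu> lam N m :: nat and \<epsilon> :: real and c :: "nat set \<Rightarrow> int"
  assumes "\<mu> \<ge> 2" and "lam \<ge> 1" and "\<epsilon> \<ge> log (real \<mu>) 2"
    and "N > 0"
    and "log 2 (real N) \<ge> 4 * real \<mu> powr (2 + \<epsilon>) + (1 + 1 / \<epsilon>) * real lam"
    and "m > 0"
    and "coprime_to \<mu> c (int N)"
  shows "real (card {x \<in> PiE {..<\<mu>} (\<lambda>_. {0..<int m}). ml_eval \<mu> c x mod int N = 0})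
           / real m ^ \<mu> \<le> 2 powr (- real lam) + real \<mu> / real m"
proof -
  interpret parameters \<mu> \<epsilon> using assms by unfold_locales
  let ?P = "prime_factors N" and ?r = "\<lambda>p. multiplicity p N"
  \<comment> \<open>The summand 0 is the initial base exponent: by coprimality no prime factor of
    \<open>N\<close> divides all coefficients.\<close>
  let ?Z = "{x \<in> PiE {..<\<mu>} (\<lambda>_. {0..<int m}). \<forall>p\<in>?P. int p ^ (0 + ?r p) dvd ml_eval \<mu> c x}"
  have "int p ^ ?r p dvd z" if "z mod int N = 0" for z p
    using that multiplicity_dvd[of p N]
    by (metis dvd_trans mod_0_imp_dvd of_nat_dvd_iff of_nat_power)
  then have "card {x \<in> PiE {..<\<mu>} (\<lambda>_. {0..<int m}). ml_eval \<mu> c x mod int N = 0} \<le> card ?Z"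
    by (intro card_mono finite_subset[OF _ finite_PiE[of "{..<\<mu>}" "\<lambda>_. {0..<int m}"]]) auto
  then have "real (card {x \<in> PiE {..<\<mu>} (\<lambda>_. {0..<int m}). ml_eval \<mu> c x mod int N = 0})
      \<le> real (card ?Z)" by simp
  also have "\<dots> \<le> real m ^ \<mu> * (real \<mu> / real m + (\<Prod>p\<in>?P. nbtail (1 / real p) \<mu> (?r p)))"
    using assms coprime_to_prime_factor by (intro card_zeros_le) (auto simp: in_prime_factors_iff)
  also have "\<dots> \<le> real m ^ \<mu> * (real \<mu> / real m + 2 powr (- real lam))"
    using assms by (intro mult_left_mono add_left_mono prod_nbtail_le) auto
  finally show ?thesis
    using assms by (simp add: divide_le_eq algebra_simps)
qed

end
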